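(* Let $S=R\cup B$ be a finite nonempty set of points in general position in the plane, colored with two colors, where $R$ is the set of red points and $B$ is the set of blue points ($R\cap B=\emptyset$). Let $r=|R|$, $b=|B|$, and let $D_2=\max_{I\in\mathcal{I}_2}\operatorname{disc}(I)$ be the maximum discrepancy of a $2$-separable island of $S$. Then $$\max\left\{\frac{\mathcal{C}(S)}{128},\ \frac{\mathcal{C}(S)}{64}-|r-b|\right\}\ \le\ \max\left\{\frac{D_2}{8},\ \frac{D_2}{4}-|r-b|\right\}\ \le\ \mathcal{C}(S).$$
   Context: General position means that no three points of $S$ are collinear. For $Y\subseteq S$, the discrepancy of $Y$ is $\operatorname{disc}(Y)=\bigl||Y\cap R|-|Y\cap B|\bigr|$. An island of $S$ is a subset $I\subseteq S$ such that $I=C\cap S$ for some convex set $C\subseteq\mathbb{R}^2$. For a positive integer $k$, an island $I$ is $k$-separable if there are halfplanes $H_1,\dots,H_t$ with $1\le t\le k$ such that $I=S\cap(H_1\cap\dots\cap H_t)$; $\mathcal{I}_k$ denotes the family of all $k$-separable islands of $S$. A convex partition of $S$ is a partition $\Pi=\{S_1,\dots,S_m\}$ of $S$ into (nonempty) islands with pairwise disjoint convex hulls; its discrepancy is $\operatorname{disc}(\Pi)=\min_{1\le i\le m}\operatorname{disc}(S_i)$. The coarseness of the colored set $S$ is $\mathcal{C}(S)=\max_{\Pi}\operatorname{disc}(\Pi)$, the maximum over all convex partitions $\Pi$ of $S$. *)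

theory Defs
  imports "HOL-Analysis.Analysis"
begin

type_synonym point = "real ^ 2"

definition general_position :: "point set \<Rightarrow> bool" where
  "general_position S \<longleftrightarrow>
     (\<forall>x\<in>S. \<forall>y\<in>S. \<forall>z\<in>S. x \<noteq> y \<and> x \<noteq> z \<and> y \<noteq> z \<longrightarrow> \<not> collinear {x, y, z})"

definition disc :: "point set \<Rightarrow> point set \<Rightarrow> point set \<Rightarrow> int" where
  "disc R B Y = \<bar>int (card (Y \<inter> R)) - int (card (Y \<inter> B))\<bar>"

definition island :: "point set \<Rightarrow> point set \<Rightarrow> bool" where
  "island S I \<longleftrightarrow> (\<exists>C. convex C \<and> I = C \<inter> S)"

(* Both closed and open halfplanes are admitted. For a finite S they cut out the same subsets. *)
definition halfplane :: "point set \<Rightarrow> bool" where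
  "halfplane H \<longleftrightarrow>
     (\<exists>a c. a \<noteq> 0 \<and> (H = {x. inner a x \<le> c} \<or> H = {x. inner a x < c}))"

definition separable_islands :: "nat \<Rightarrow> point set \<Rightarrow> point set set" where
  "separable_islands k S =
     {I. island S I \<and>
         (\<exists>t (H :: nat \<Rightarrow> point set). 1 \<le> t \<and> t \<le> k \<and> (\<forall>i\<in>{1..t}. halfplane (H i)) \<and>
            I = S \<inter> (\<Inter>i\<in>{1..t}. H i))}"

definition convex_partition :: "point set \<Rightarrow> point set set \<Rightarrow> bool" where
  "convex_partition S P \<longleftrightarrow>
     partition_on S P \<and> (\<forall>I\<in>P. island S I) \<and>
     pairwise (\<lambda>I J. convex hull I \<inter> convex hull J = {}) P"

definition disc_partition :: "point set \<Rightarrow> point set \<Rightarrow> point set set \<Rightarrow> int" where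
  "disc_partition R B P = Min (disc R B ` P)"

definition coarseness :: "point set \<Rightarrow> point set \<Rightarrow> int" where
  "coarseness R B = Max (disc_partition R B ` {P. convex_partition (R \<union> B) P})"

text \<open>The extrema above range over finite nonempty sets.\<close>

lemma convex_partition_finite_nonempty:
  assumes "finite S" "S \<noteq> {}" "convex_partition S P"
  shows "finite P" "P \<noteq> {}"
  using assms finite_elements[of S P] by (auto simp: convex_partition_def partition_on_def)

lemma finite_convex_partitions:
  assumes "finite S"
  shows "finite {P. convex_partition S P}"
proof (rule finite_subset)
  show "{P. convex_partition S P} \<subseteq> Pow (Pow S)"
    by (auto simp: convex_partition_def partition_on_def)
qed (use assms in simp)

lemma convex_partition_trivial:
  assumes "S \<noteq> {}"
  shows "convex_partition S {S}"
proof -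
  have "island S S"
    unfolding island_def by (rule exI[of _ UNIV]) auto
  then show ?thesis
    using assms by (simp add: convex_partition_def partition_on_space)
qed

lemma finite_separable_islands:
  assumes "finite S"
  shows "finite (separable_islands k S)"
proof (rule finite_subset)
  show "separable_islands k S \<subseteq> Pow S"
    by (auto simp: separable_islands_def)
qed (use assms in simp)

lemma self_in_separable_islands:
  assumes "finite S" "1 \<le> k"
  shows "S \<in> separable_islands k S"
proof -
  define a :: point where "a = axis 1 1"
  define c where "c = Max (insert 0 (inner a ` S))"
  define H where "H = {x. inner a x \<le> c}"
  have "a \<noteq> 0"
    by (simp add: a_def axis_eq_0_iff)
  then have "halfplane H"
    unfolding halfplane_def H_def by blast
  moreover have "S \<subseteq> H"
    using assms(1) by (auto simp: H_def c_def)
  then have "S = S \<inter> (\<Inter>i\<in>{1..1::nat}. H)"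
    by auto
  moreover have "island S S"
    unfolding island_def by (rule exI[of _ UNIV]) auto
  ultimately show ?thesis
    unfolding separable_islands_def using assms(2)
    by (intro CollectI conjI exI[of _ "1::nat"] exI[of _ "\<lambda>_. H"]) auto
qed

end

(* The left inequality holds because C(S) <= 12 D_2. Project S injectively onto a line and sweep a
   transversal line across the parts of a convex partition. In each column, a part is what lies
   below a line separating it from its upper neighbour minus what lies below a line separating it
   from its lower neighbour. Summed over the columns, each maximal run with a constant neighbour
   telescopes to a difference of two 2-separable islands. The neighbour of some other part changes
   only when the sweep leaves or enters a part, and then for one part above and one below. So the
   m parts have at most 6m runs, and their discrepancies add up to at most 12 m D_2.

   The right inequality follows from |r - b| <= C(S), witnessed by the partition {S}, and
   D_2 / 4 - |r - b| <= C(S). For the latter, let H and G be the halfplanes of an optimal island.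
   If one of them has discrepancy at least D_2 / 4, take it together with its complement. Otherwise
   additivity of the signed count makes the four quadrants of H and G a suitable partition. *)
theory Submission
  imports Defs
begin

section \<open>Telescoping along a sweep and counting changes of neighbour\<close>

text \<open>On a maximal run with constant \<open>u\<close> the sum telescopes to two values of
  \<open>F\<close>, hence costs at most \<open>2 * M\<close>; there is one run more than there are
  changes.\<close>

lemma telescope_bound:
  fixes F :: "'u \<Rightarrow> nat \<Rightarrow> int" and M :: int
  assumes F: "\<And>u t. \<bar>F u t\<bar> \<le> M" and "l \<le> r"
  shows "\<bar>\<Sum>t\<in>{l..r}. F (u t) (Suc t) - F (u t) t\<bar>
           \<le> 2 * M + 2 * M * int (card {t \<in> {l..<r}. u t \<noteq> u (Suc t)})"
proof -
  \<comment> \<open>With the end value of the current run taken out, adding a column alters the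
    expression only if \<open>u\<close> changes there.\<close>
  have "\<bar>(\<Sum>t\<in>{l..r}. F (u t) (Suc t) - F (u t) t) - F (u r) (Suc r)\<bar>
          \<le> M + 2 * M * int (card {t \<in> {l..<r}. u t \<noteq> u (Suc t)})"
    using \<open>l \<le> r\<close>
  proof (induction r rule: dec_induct)
    case base
    then show ?case using F[of "u l" l] by simp
  next
    case (step r)
    let ?Z = "\<lambda>r. {t \<in> {l..<r}. u t \<noteq> u (Suc t)}"
    have Z: "?Z (Suc r) = (if u r = u (Suc r) then ?Z r else insert r (?Z r))"
      using step.hyps by (auto simp: less_Suc_eq)
    have "int (card (?Z (Suc r))) = int (card (?Z r)) + (if u r = u (Suc r) then 0 else 1)"
      unfolding Z by simp
    moreover have "\<bar>F (u r) (Suc r) - F (u (Suc r)) (Suc r)\<bar> \<le> (if u r = u (Suc r) then 0 else 2 * M)"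
      using F[of "u r" "Suc r"] F[of "u (Suc r)" "Suc r"] by auto
    ultimately show ?case
      using step by (auto simp: algebra_simps split: if_splits)
  qed
  then show ?thesis
    using F[of "u r" "Suc r"] by linarith
qed

text \<open>A change of \<open>up j\<close> between columns t and t + 1 is charged to a neighbour
  that ends at t or begins at t + 1. Each element is charged at most once for either end, because in
  that column only one \<open>j\<close> has it as its upper neighbour.\<close>

lemma card_neighbour_changes:
  fixes P :: "'a set" and l r :: "'a \<Rightarrow> nat" and h :: "'a \<Rightarrow> nat \<Rightarrow> real"
    and up :: "'a \<Rightarrow> nat \<Rightarrow> 'a option" and act :: "'a \<Rightarrow> nat \<Rightarrow> bool"
  assumes fin: "finite P" and inj_l: "inj_on l P" and inj_r: "inj_on r P"
    and act: "\<And>j t. act j t \<longleftrightarrow> j \<in> P \<and> l j \<le> t \<and> t \<le> r j"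
    and up_None: "\<And>j t i. act j t \<Longrightarrow> act i t \<Longrightarrow> up j t = None \<Longrightarrow> \<not> h j t < h i t"
    and up_Some: "\<And>j t u. act j t \<Longrightarrow> up j t = Some u \<Longrightarrow>
        act u t \<and> h j t < h u t \<and> (\<forall>i. act i t \<longrightarrow> h j t < h i t \<longrightarrow> h u t \<le> h i t)"
    and inj_h: "\<And>i j t. act i t \<Longrightarrow> act j t \<Longrightarrow> h i t = h j t \<Longrightarrow> i = j"
    and mono_h: "\<And>i j s t. act i s \<Longrightarrow> act j s \<Longrightarrow> act i t \<Longrightarrow> act j t \<Longrightarrow>
        h i s < h j s \<Longrightarrow> h i t < h j t"
  shows "(\<Sum>j\<in>P. card {t \<in> {l j..<r j}. up j t \<noteq> up j (Suc t)}) \<le> 2 * card P"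
proof -
  define Z where "Z = (SIGMA j:P. {t \<in> {l j..<r j}. up j t \<noteq> up j (Suc t)})"
  define Z1 where "Z1 = {(j, t). act j t \<and> (\<exists>u. up j t = Some u \<and> r u = t)}"
  define Z2 where "Z2 = {(j, t). act j (Suc t) \<and> (\<exists>u. up j (Suc t) = Some u \<and> l u = Suc t)}"
  \<comment> \<open>Of two elements with the same upper neighbour, the lower one would have the
    higher one as a nearer neighbour.\<close>
  have up_inj: "i = j" if ij: "act i t" "act j t" "up i t = Some u" "up j t = Some u" for i j t u
  proof (rule inj_h[OF ij(1,2)], rule ccontr)
    have "h i t < h u t" "h j t < h u t"
      "h i t < h j t \<Longrightarrow> h u t \<le> h j t" "h j t < h i t \<Longrightarrow> h u t \<le> h i t"
      using up_Some[OF ij(1,3)] up_Some[OF ij(2,4)] ij(1,2) by blast+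
    moreover assume "h i t \<noteq> h j t"
    ultimately show False by linarith
  qed
  have in_P: "j \<in> P" if "act j t" for j t
    using that by (simp add: act)
  have card1: "card Z1 \<le> card P"
  proof (rule card_inj_on_le[OF _ _ fin])
    show "inj_on (\<lambda>(j, t). the (up j t)) Z1"
      using up_inj by (auto simp: inj_on_def Z1_def)
    show "(\<lambda>(j, t). the (up j t)) ` Z1 \<subseteq> P"
      unfolding Z1_def using up_Some[THEN conjunct1] in_P by fastforce
  qed
  have card2: "card Z2 \<le> card P"
  proof (rule card_inj_on_le[OF _ _ fin])
    show "inj_on (\<lambda>(j, t). the (up j (Suc t))) Z2"
    proof (rule inj_onI, clarify)
      fix i s j t assume a: "(i, s) \<in> Z2" "(j, t) \<in> Z2" "the (up i (Suc s)) = the (up j (Suc t))"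
      then obtain u where u: "up i (Suc s) = Some u" "l u = Suc s" "up j (Suc t) = Some u" "l u = Suc t"
        "act i (Suc s)" "act j (Suc t)"
        by (auto simp: Z2_def)
      then show "i = j \<and> s = t" using up_inj[of i "Suc s" j u] by auto
    qed
    show "(\<lambda>(j, t). the (up j (Suc t))) ` Z2 \<subseteq> P"
      unfolding Z2_def using up_Some[THEN conjunct1] in_P by fastforce
  qed
  have "Z \<subseteq> Z1 \<union> Z2"
  proof (clarify)
    fix j t assume jt: "(j, t) \<in> Z" "(j, t) \<notin> Z2"
    then have j: "act j t" "act j (Suc t)" and ne: "up j t \<noteq> up j (Suc t)"
      by (auto simp: Z_def act)
    have old: "act u' t" if "up j (Suc t) = Some u'" for u'
      using up_Some[OF j(2) that] jt(2) j that by (auto simp: Z2_def act)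
    show "(j, t) \<in> Z1"
    proof (rule ccontr)
      assume "(j, t) \<notin> Z1"
      then have stay: "act u (Suc t)" if "up j t = Some u" for u
        using up_Some[OF j(1) that] j that by (auto simp: Z1_def act)
      have less_new: "up j (Suc t) \<noteq> None \<and> h (the (up j (Suc t))) (Suc t) \<le> h u (Suc t)"
        if u: "up j t = Some u" for u
      proof -
        have "h j (Suc t) < h u (Suc t)"
          using mono_h[of j t u "Suc t"] up_Some[OF j(1) u] stay[OF u] j by auto
        then show ?thesis
          using up_None[OF j(2) stay[OF u]] up_Some[OF j(2)] stay[OF u] by (metis option.collapse)
      qed
      have less_old: "up j t \<noteq> None \<and> h (the (up j t)) t \<le> h u t"
        if u: "up j (Suc t) = Some u" for u
      proof -
        have "h j t < h u t"
          using mono_h[of j "Suc t" u t] up_Some[OF j(2) u] old[OF u] j by auto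
        then show ?thesis
          using up_None[OF j(1) old[OF u]] up_Some[OF j(1)] old[OF u] by (metis option.collapse)
      qed
      \<comment> \<open>Old and new neighbour are now both active in both columns. Each is nearest
        in its own column, and their order does not change, so they coincide.\<close>
      obtain u u' where u: "up j t = Some u" and u': "up j (Suc t) = Some u'"
        using ne less_new less_old by (cases "up j t"; cases "up j (Suc t)") auto
      have "h u' (Suc t) \<le> h u (Suc t)" "h u t \<le> h u' t"
        using less_new[OF u] less_old[OF u'] u u' by auto
      moreover have "act u t" "act u' t" "act u (Suc t)" "act u' (Suc t)"
        using up_Some[OF j(1) u] up_Some[OF j(2) u'] stay[OF u] old[OF u'] by auto
      ultimately have "u = u'"
        using mono_h[of u t u' "Suc t"] inj_h[of u t u'] by linarith
      then show False using ne u u' by simp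
    qed
  qed
  moreover have "finite (Z1 \<union> Z2)"
  proof (rule finite_subset)
    show "Z1 \<union> Z2 \<subseteq> (SIGMA j:P. {..r j})"
      by (auto simp: Z1_def Z2_def act)
  qed (use fin in auto)
  ultimately have "card Z \<le> card Z1 + card Z2"
    by (meson card_Un_le card_mono order_trans)
  moreover have "card Z = (\<Sum>j\<in>P. card {t \<in> {l j..<r j}. up j t \<noteq> up j (Suc t)})"
    unfolding Z_def using fin by (intro card_SigmaI) auto
  ultimately show ?thesis using card1 card2 by simp
qed

section \<open>Signed counts and lower bounds for the coarseness\<close>

text \<open>The discrepancy without its absolute value: this signed count is additive over disjoint
  sets.\<close>

definition weight :: "point set \<Rightarrow> point set \<Rightarrow> point set \<Rightarrow> int" where
  "weight R B Y = int (card (Y \<inter> R)) - int (card (Y \<inter> B))"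

lemma disc_eq_abs_weight: "disc R B Y = \<bar>weight R B Y\<bar>"
  by (simp add: disc_def weight_def)

lemma weight_Un:
  assumes "finite (R \<union> B)" "X \<inter> Y = {}"
  shows "weight R B (X \<union> Y) = weight R B X + weight R B Y"
proof -
  have "card ((X \<union> Y) \<inter> T) = card (X \<inter> T) + card (Y \<inter> T)" if "finite T" for T
    using that assms(2) card_Un_disjoint[of "X \<inter> T" "Y \<inter> T"] by (auto simp: Int_Un_distrib2)
  then show ?thesis using assms(1) by (simp add: weight_def)
qed

lemma weight_eq_sum:
  assumes "finite Y" "R \<inter> B = {}" "Y \<subseteq> R \<union> B"
  shows "weight R B Y = (\<Sum>p\<in>Y. if p \<in> R then 1 else - 1)"
proof -
  have "Y \<inter> - R = Y \<inter> B" using assms by auto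
  then show ?thesis
    using assms(1) by (simp add: weight_def sum.If_cases Int_def)
qed

text \<open>The hull of each trace stays inside its convex cell, so disjoint cells induce a convex
  partition. Positivity of \<open>k\<close> keeps the traces nonempty.\<close>

lemma coarseness_ge_cells:
  assumes fin: "finite (R \<union> B)" and "finite Q" "Q \<noteq> {}" and conv: "\<And>K. K \<in> Q \<Longrightarrow> convex K"
    and disj: "pairwise disjnt Q" and cover: "R \<union> B \<subseteq> \<Union>Q"
    and "0 < k" and k: "\<And>K. K \<in> Q \<Longrightarrow> k \<le> disc R B (K \<inter> (R \<union> B))"
  shows "k \<le> coarseness R B"
proof -
  let ?S = "R \<union> B"
  let ?P = "(\<lambda>K. K \<inter> ?S) ` Q"
  have ne: "K \<inter> ?S \<noteq> {}" if "K \<in> Q" for K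
    using k[OF that] \<open>0 < k\<close> by (auto simp: disc_def)
  have hull: "convex hull (K \<inter> ?S) \<subseteq> K" if "K \<in> Q" for K
    using conv[OF that] by (simp add: hull_minimal)
  have "partition_on ?S ?P"
  proof (rule partition_onI)
    show "\<Union>?P = ?S" using cover by auto
    show "{} \<notin> ?P" using ne by (metis (mono_tags, lifting) imageE)
    show "\<And>p q. p \<in> ?P \<Longrightarrow> q \<in> ?P \<Longrightarrow> p \<noteq> q \<Longrightarrow> disjnt p q"
      using disj by (auto simp: pairwise_def disjnt_def)
  qed
  moreover have "\<forall>I\<in>?P. island ?S I"
    using conv by (auto simp: island_def)
  moreover have "pairwise (\<lambda>I J. convex hull I \<inter> convex hull J = {}) ?P"
    unfolding pairwise_def
  proof clarify
    fix K L assume KL: "K \<in> Q" "L \<in> Q" "K \<inter> ?S \<noteq> L \<inter> ?S"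
    then have "K \<inter> L = {}"
      using disj by (auto simp: pairwise_def disjnt_def)
    then show "convex hull (K \<inter> ?S) \<inter> convex hull (L \<inter> ?S) = {}"
      using hull KL by blast
  qed
  ultimately have P: "convex_partition ?S ?P"
    by (simp add: convex_partition_def)
  then have "disc_partition R B ?P \<le> coarseness R B"
    unfolding coarseness_def using finite_convex_partitions[OF fin] by (intro Max_ge) auto
  moreover have "k \<le> disc_partition R B ?P"
    unfolding disc_partition_def using \<open>finite Q\<close> \<open>Q \<noteq> {}\<close> k by (subst Min_ge_iff) auto
  ultimately show ?thesis by simp
qed

lemma convex_halfplane: "halfplane H \<Longrightarrow> convex H"
  unfolding halfplane_def using convex_halfspace_le convex_halfspace_lt by metis

lemma convex_Compl_halfplane: "halfplane H \<Longrightarrow> convex (- H)"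
proof -
  have "- {x. inner a x \<le> c} = {x. c < inner a x}" "- {x. inner a x < c} = {x. c \<le> inner a x}"
    for a :: point and c by auto
  then show "halfplane H \<Longrightarrow> convex (- H)"
    unfolding halfplane_def using convex_halfspace_gt convex_halfspace_ge by metis
qed

lemma weight_le_coarseness:
  assumes "finite (R \<union> B)" "R \<union> B \<noteq> {}"
  shows "\<bar>weight R B (R \<union> B)\<bar> \<le> coarseness R B"
proof -
  have "disc_partition R B {R \<union> B} \<le> coarseness R B"
    unfolding coarseness_def
    using finite_convex_partitions[OF assms(1)] convex_partition_trivial[OF assms(2)]
    by (intro Max_ge) auto
  then show ?thesis by (simp add: disc_partition_def disc_eq_abs_weight)
qed

text \<open>Cut along the boundary of \<open>H\<close>: the counts on the two sides add up to the
  total, so the complement loses at most the absolute total. A nonpositive bound gives no usable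
  cells and is left to the trivial partition.\<close>

lemma coarseness_ge_halfplane:
  assumes fin: "finite (R \<union> B)" and "R \<union> B \<noteq> {}" and H: "halfplane H"
  shows "\<bar>weight R B (H \<inter> (R \<union> B))\<bar> - \<bar>weight R B (R \<union> B)\<bar> \<le> coarseness R B" (is "?k \<le> _")
proof (cases "0 < ?k")
  case True
  have "weight R B ((H \<inter> (R \<union> B)) \<union> (- H \<inter> (R \<union> B)))
      = weight R B (H \<inter> (R \<union> B)) + weight R B (- H \<inter> (R \<union> B))"
    by (rule weight_Un[OF fin]) auto
  moreover have "(H \<inter> (R \<union> B)) \<union> (- H \<inter> (R \<union> B)) = R \<union> B"
    by auto
  ultimately have sum: "weight R B (R \<union> B) = weight R B (H \<inter> (R \<union> B)) + weight R B (- H \<inter> (R \<union> B))"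
    by simp
  show ?thesis
  proof (rule coarseness_ge_cells[OF fin, of "{H, - H}"])
    fix K assume "K \<in> {H, - H}"
    then show "?k \<le> disc R B (K \<inter> (R \<union> B))"
      using sum by (auto simp: disc_eq_abs_weight)
  qed (use True convex_halfplane[OF H] convex_Compl_halfplane[OF H] in \<open>auto simp: pairwise_def disjnt_def\<close>)
next
  case False
  then show ?thesis using weight_le_coarseness[OF assms(1,2)] by linarith
qed

text \<open>Here \<open>p\<close>, \<open>q\<close>, \<open>u\<close>, \<open>v\<close> are the
  counts of the four quadrants, \<open>h\<close>, \<open>h'\<close>, \<open>g\<close> those of
  \<open>H\<close>, its complement and \<open>G\<close>, and \<open>s\<close> is the total. Since
  \<open>h\<close> and \<open>g\<close> are small against \<open>p\<close>, both \<open>q\<close>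
  and \<open>u\<close> nearly cancel \<open>p\<close>; since \<open>h'\<close> is also small,
  \<open>v\<close> nearly cancels \<open>u\<close>.\<close>

lemma quadrant_arithmetic:
  fixes k s p q u v g h h' :: int
  assumes "4 * k < \<bar>p\<bar> - 4 * \<bar>s\<bar>" "h = p + q" "g = p + u" "h' = u + v" "s = h + h'"
    "\<bar>h\<bar> - \<bar>s\<bar> < k + 1" "\<bar>g\<bar> - \<bar>s\<bar> < k + 1"
  shows "k + 1 \<le> \<bar>p\<bar> \<and> k + 1 \<le> \<bar>q\<bar> \<and> k + 1 \<le> \<bar>u\<bar> \<and> k + 1 \<le> \<bar>v\<bar>"
  using assms by (smt (verit))

lemma coarseness_ge_wedge:
  assumes fin: "finite (R \<union> B)" and ne: "R \<union> B \<noteq> {}" and H: "halfplane H" "halfplane G"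
  shows "\<bar>weight R B (H \<inter> G \<inter> (R \<union> B))\<bar> - 4 * \<bar>weight R B (R \<union> B)\<bar> \<le> 4 * coarseness R B"
proof (rule ccontr)
  let ?S = "R \<union> B"
  let ?w = "\<lambda>K. weight R B (K \<inter> ?S)"
  \<comment> \<open>The least integer above the coarseness: no halfplane count reaches it beyond the
    total, yet all four quadrants will.\<close>
  let ?k = "coarseness R B + 1"
  assume "\<not> ?thesis"
  then have big: "4 * coarseness R B < \<bar>?w (H \<inter> G)\<bar> - 4 * \<bar>weight R B ?S\<bar>"
    by simp
  have split: "?w K = ?w (K \<inter> L) + ?w (K \<inter> - L)" for K L
  proof -
    have "K \<inter> ?S = (K \<inter> L \<inter> ?S) \<union> (K \<inter> - L \<inter> ?S)" by auto
    then show ?thesis using weight_Un[OF fin, of "K \<inter> L \<inter> ?S" "K \<inter> - L \<inter> ?S"] by auto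
  qed
  have pos: "0 < ?k"
    using weight_le_coarseness[OF fin ne] by linarith
  have eqs: "?w H = ?w (H \<inter> G) + ?w (H \<inter> - G)" "?w G = ?w (H \<inter> G) + ?w (- H \<inter> G)"
    "?w (- H) = ?w (- H \<inter> G) + ?w (- H \<inter> - G)" "weight R B ?S = ?w H + ?w (- H)"
    using split[of H G] split[of G H] split[of "- H" G] split[of UNIV H] by (auto simp: Int_commute)
  have bounds: "\<bar>?w H\<bar> - \<bar>weight R B ?S\<bar> < ?k" "\<bar>?w G\<bar> - \<bar>weight R B ?S\<bar> < ?k"
    using coarseness_ge_halfplane[OF fin ne H(1)] coarseness_ge_halfplane[OF fin ne H(2)] by auto
  have "?k \<le> coarseness R B"
  proof (rule coarseness_ge_cells[OF fin, of "{H \<inter> G, H \<inter> - G, - H \<inter> G, - H \<inter> - G}"])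
    have "?k \<le> \<bar>?w (H \<inter> G)\<bar> \<and> ?k \<le> \<bar>?w (H \<inter> - G)\<bar> \<and> ?k \<le> \<bar>?w (- H \<inter> G)\<bar> \<and> ?k \<le> \<bar>?w (- H \<inter> - G)\<bar>"
      using quadrant_arithmetic[OF big eqs bounds] by blast
    then show "?k \<le> disc R B (K \<inter> ?S)"
      if "K \<in> {H \<inter> G, H \<inter> - G, - H \<inter> G, - H \<inter> - G}" for K
      unfolding disc_eq_abs_weight using that by blast
  qed (use pos convex_halfplane[OF H(1)] convex_halfplane[OF H(2)] convex_Compl_halfplane[OF H(1)]
      convex_Compl_halfplane[OF H(2)] in \<open>auto simp: pairwise_def disjnt_def intro: convex_Int\<close>)
  then show False by simp
qed

section \<open>Islands cut out by two halfplanes\<close>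

lemma separable_islands_2:
  "separable_islands 2 S = {H \<inter> G \<inter> S | H G. halfplane H \<and> halfplane G}"
proof (intro equalityI subsetI)
  fix I assume "I \<in> separable_islands 2 S"
  then obtain t :: nat and H where t: "1 \<le> t" "t \<le> 2" and H: "\<forall>i\<in>{1..t}. halfplane (H i)"
    and I: "I = S \<inter> (\<Inter>i\<in>{1..t}. H i)"
    unfolding separable_islands_def by blast
  \<comment> \<open>This covers t = 1 as well, where the single halfplane is used twice.\<close>
  have "{1..t} = {1, t}"
    using t by auto
  then have "halfplane (H 1)" "halfplane (H t)" "I = H 1 \<inter> H t \<inter> S"
    using H I by auto
  then show "I \<in> {H \<inter> G \<inter> S | H G. halfplane H \<and> halfplane G}"
    by blast
next
  fix I assume "I \<in> {H \<inter> G \<inter> S | H G. halfplane H \<and> halfplane G}"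
  then obtain H G where HG: "halfplane H" "halfplane G" and I: "I = H \<inter> G \<inter> S"
    by blast
  define f where "f = (\<lambda>i::nat. if i = 1 then H else G)"
  have "{1..2::nat} = {1, 2}"
    by auto
  then have "\<forall>i\<in>{1..2}. halfplane (f i)" "I = S \<inter> (\<Inter>i\<in>{1..2}. f i)"
    using HG I by (auto simp: f_def)
  moreover have "island S I"
    unfolding island_def I using HG convex_halfplane by (blast intro: convex_Int)
  ultimately show "I \<in> separable_islands 2 S"
    unfolding separable_islands_def by (intro CollectI conjI exI[of _ "2::nat"] exI[of _ f]) auto
qed

lemma disc_wedge_le_Max:
  assumes "finite S" "halfplane H" "halfplane G"
  shows "disc R B (H \<inter> G \<inter> S) \<le> Max (disc R B ` separable_islands 2 S)"
  using finite_separable_islands[OF assms(1), of 2] assms(2,3)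
  by (intro Max_ge) (auto simp: separable_islands_2)

section \<open>Coordinates for the sweep\<close>

text \<open>Among the directions (1, s), each pair of distinct points rules out at most one s, and
  there are only finitely many pairs.\<close>

lemma ex_injective_direction:
  fixes S :: "point set"
  assumes "finite S"
  shows "\<exists>a. a \<noteq> 0 \<and> inj_on (inner a) S"
proof -
  define v :: "real \<Rightarrow> point" where "v = (\<lambda>s. vector [1, s])"
  have inner_v: "inner (v s) p = p $ 1 + s * p $ 2" for s p
    by (simp add: v_def inner_vec_def sum_2)
  have "finite {s. inner (v s) p = inner (v s) q}" if "p \<noteq> q" for p q
  proof (rule finite_subset)
    show "{s. inner (v s) p = inner (v s) q} \<subseteq> {(p $ 1 - q $ 1) / (q $ 2 - p $ 2)}"
    proof clarify
      fix s assume "inner (v s) p = inner (v s) q"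
      then have eq: "p $ 1 - q $ 1 = s * (q $ 2 - p $ 2)"
        by (simp add: inner_v algebra_simps)
      moreover have "q $ 2 \<noteq> p $ 2"
        using eq that by (auto simp: vec_eq_iff forall_2)
      ultimately show "s = (p $ 1 - q $ 1) / (q $ 2 - p $ 2)"
        by simp
    qed
  qed simp
  then have "finite (\<Union>(p, q)\<in>{(p, q). p \<in> S \<and> q \<in> S \<and> p \<noteq> q}. {s. inner (v s) p = inner (v s) q})"
    using assms by (intro finite_UN_I finite_subset[of "{(p, q). p \<in> S \<and> q \<in> S \<and> p \<noteq> q}" "S \<times> S"]) auto
  then obtain s where
    "s \<notin> (\<Union>(p, q)\<in>{(p, q). p \<in> S \<and> q \<in> S \<and> p \<noteq> q}. {s. inner (v s) p = inner (v s) q})"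
    using infinite_UNIV_char_0 ex_new_if_finite by blast
  then have "inj_on (inner (v s)) S"
    by (auto simp: inj_on_def)
  moreover have "v s \<noteq> 0"
    using inner_v[of s "axis 1 1"] by (auto simp: axis_def)
  ultimately show ?thesis
    by blast
qed

lemma ex_sorted_enumeration:
  fixes f :: "'a \<Rightarrow> 'b::linorder"
  assumes "finite S" "inj_on f S"
  obtains e where "bij_betw e {..<card S} S" "strict_mono_on {..<card S} (f \<circ> e)"
proof -
  let ?xs = "sorted_list_of_set (f ` S)"
  have len: "length ?xs = card S"
    using assms by (simp add: card_image)
  have xs: "bij_betw (nth ?xs) {..<card S} (f ` S)"
    using assms(1) len by (intro bij_betw_nth) auto
  have inv: "bij_betw (inv_into S f) (f ` S) S"
    using assms(2) by (simp add: bij_betw_inv_into inj_on_imp_bij_betw)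
  define e where "e = inv_into S f \<circ> nth ?xs"
  show ?thesis
  proof
    show "bij_betw e {..<card S} S"
      unfolding e_def using xs inv by (rule bij_betw_trans)
    have "f (e i) = ?xs ! i" if "i < card S" for i
      using that xs by (auto simp: e_def bij_betw_def intro!: f_inv_into_f)
    then show "strict_mono_on {..<card S} (f \<circ> e)"
      using strict_sorted_list_of_set[of "f ` S"] len
      by (auto simp: strict_mono_on_def sorted_wrt_iff_nth_less)
  qed
qed

text \<open>Expansion in the orthogonal basis \<open>a\<close>, \<open>a'\<close>. The quarter turn
  \<open>a'\<close> has the same length as \<open>a\<close>, which explains the common
  denominator.\<close>

lemma inner_orthogonal_coordinates:
  fixes a n p :: point
  assumes "a \<noteq> 0"
  defines "a' \<equiv> vector [- (a $ 2), a $ 1]"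
  shows "inner n p = inner n a / inner a a * inner a p + inner n a' / inner a a * inner a' p"
proof -
  have "inner a a \<noteq> 0"
    using assms by simp
  moreover have "inner n p * inner a a = inner n a * inner a p + inner n a' * inner a' p"
    by (simp add: a'_def inner_vec_def sum_2 algebra_simps)
  ultimately show ?thesis
    by (simp add: field_simps)
qed

section \<open>Neighbours in a column and the cost of a sweep\<close>

text \<open>\<open>None\<close> marks a topmost element. Applied to negated heights, it yields the
  neighbour below.\<close>

definition next_above :: "('a \<Rightarrow> nat \<Rightarrow> bool) \<Rightarrow> ('a \<Rightarrow> nat \<Rightarrow> real) \<Rightarrow> 'a \<Rightarrow> nat \<Rightarrow> 'a option" where
  "next_above act h j t =
     (let A = {i. act i t \<and> h j t < h i t}
      in if A = {} then None else Some (arg_min_on (\<lambda>i. h i t) A))"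

lemma next_above_None:
  "next_above act h j t = None \<Longrightarrow> act i t \<Longrightarrow> h i t \<le> h j t"
  by (auto simp: next_above_def Let_def not_less split: if_splits)

lemma next_above_Some:
  assumes "finite {i. act i t}" "next_above act h j t = Some u"
  shows "act u t" "h j t < h u t" "\<And>i. act i t \<Longrightarrow> h j t < h i t \<Longrightarrow> h u t \<le> h i t"
proof -
  let ?A = "{i. act i t \<and> h j t < h i t}"
  have A: "finite ?A" "?A \<noteq> {}" "u = arg_min_on (\<lambda>i. h i t) ?A"
    using assms by (auto simp: next_above_def Let_def split: if_splits)
  then show "act u t" "h j t < h u t"
    using arg_min_if_finite(1)[OF A(1,2), of "\<lambda>i. h i t"] by auto
  show "h u t \<le> h i t" if "act i t" "h j t < h i t" for i
    using arg_min_least[OF A(1,2), of i "\<lambda>i. h i t"] that A(3) by auto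
qed

text \<open>With m elements there are at most 2m changes of neighbour, hence 3m runs, each costing
  \<open>2 * M\<close>.\<close>

lemma sweep_bound:
  fixes P :: "'a set" and l r :: "'a \<Rightarrow> nat" and h :: "'a \<Rightarrow> nat \<Rightarrow> real"
    and F :: "'a \<Rightarrow> 'a option \<Rightarrow> nat \<Rightarrow> int" and M :: int
  defines "act \<equiv> \<lambda>j t. j \<in> P \<and> l j \<le> t \<and> t \<le> r j"
  assumes fin: "finite P" and inj_l: "inj_on l P" and inj_r: "inj_on r P"
    and le: "\<And>j. j \<in> P \<Longrightarrow> l j \<le> r j"
    and inj_h: "\<And>i j t. act i t \<Longrightarrow> act j t \<Longrightarrow> h i t = h j t \<Longrightarrow> i = j"
    and mono_h: "\<And>i j s t. act i s \<Longrightarrow> act j s \<Longrightarrow> act i t \<Longrightarrow> act j t \<Longrightarrow>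
        h i s < h j s \<Longrightarrow> h i t < h j t"
    and F: "\<And>j u t. \<bar>F j u t\<bar> \<le> M"
  defines "up \<equiv> next_above act h"
  shows "(\<Sum>j\<in>P. \<bar>\<Sum>t\<in>{l j..r j}. F j (up j t) (Suc t) - F j (up j t) t\<bar>) \<le> 6 * M * int (card P)"
proof -
  let ?c = "\<lambda>j. card {t \<in> {l j..<r j}. up j t \<noteq> up j (Suc t)}"
  have fin_act: "finite {i. act i t}" for t
    using fin by (auto simp: act_def)
  have "(\<Sum>j\<in>P. ?c j) \<le> 2 * card P"
  proof (rule card_neighbour_changes[OF fin inj_l inj_r, where act = act and h = h])
    show "act j t \<longleftrightarrow> j \<in> P \<and> l j \<le> t \<and> t \<le> r j" for j t
      by (simp add: act_def)
    show "\<not> h j t < h i t" if "act i t" "up j t = None" for i j t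
      using next_above_None[of act h j t i] that by (simp add: up_def not_less)
    show "act u t \<and> h j t < h u t \<and> (\<forall>i. act i t \<longrightarrow> h j t < h i t \<longrightarrow> h u t \<le> h i t)"
      if "up j t = Some u" for j t u
      using next_above_Some[OF fin_act that[unfolded up_def]] by blast
  qed (fact inj_h mono_h)+
  moreover have "0 \<le> M" if "P \<noteq> {}"
    using F[of undefined undefined undefined] by linarith
  ultimately have "2 * M * int (\<Sum>j\<in>P. ?c j) \<le> 2 * M * int (2 * card P)"
    by (cases "P = {}", simp) (intro mult_left_mono zle_int[THEN iffD2], auto)
  moreover have "(\<Sum>j\<in>P. \<bar>\<Sum>t\<in>{l j..r j}. F j (up j t) (Suc t) - F j (up j t) t\<bar>)
      \<le> (\<Sum>j\<in>P. 2 * M + 2 * M * int (?c j))"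
    by (intro sum_mono telescope_bound F le)
  ultimately show ?thesis
    by (simp add: sum.distrib sum_distrib_left algebra_simps)
qed

section \<open>Discrepancies of the parts of a convex partition\<close>

text \<open>The bound concerns the sum because a single part may change neighbours many times; only
  the total is linear in the number of parts. The sweeps for upper and lower neighbours contribute 6
  each to the factor 12.\<close>

lemma sum_disc_convex_partition_le:
  assumes fin: "finite (R \<union> B)" and RB: "R \<inter> B = {}" and cp: "convex_partition (R \<union> B) P"
  shows "(\<Sum>K\<in>P. disc R B K) \<le> 12 * Max (disc R B ` separable_islands 2 (R \<union> B)) * int (card P)"
proof -
  define S where "S = R \<union> B"
  define M where "M = Max (disc R B ` separable_islands 2 S)"
  have finS: "finite S" using fin by (simp add: S_def)
  have part: "partition_on S P"
    and hulls: "\<And>I J. I \<in> P \<Longrightarrow> J \<in> P \<Longrightarrow> I \<noteq> J \<Longrightarrow> convex hull I \<inter> convex hull J = {}"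
    using cp by (auto simp: convex_partition_def S_def pairwise_def)
  have finP: "finite P"
    using finite_elements[OF finS part] .
  have sub: "K \<subseteq> S" and ne: "K \<noteq> {}" if "K \<in> P" for K
    using part that by (auto simp: partition_on_def)
  have finK: "finite K" if "K \<in> P" for K
    using finite_subset[OF sub[OF that] finS] .
  obtain a :: point where a: "a \<noteq> 0" "inj_on (inner a) S"
    using ex_injective_direction[OF finS] by blast
  define n where "n = card S"
  obtain e where e: "bij_betw e {..<n} S" and mono_e: "strict_mono_on {..<n} (inner a \<circ> e)"
    unfolding n_def by (rule ex_sorted_enumeration[OF finS a(2)])
  define y where "y = inner (vector [- (a $ 2), a $ 1] :: point)"
  \<comment> \<open>\<open>a\<close> points along the sweep and \<open>y\<close> is the height in a column; \<open>slope v\<close> is positive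
    iff \<open>v\<close> points upwards.\<close>
  define slope :: "point \<Rightarrow> real"
    where "slope v = inner v (vector [- (a $ 2), a $ 1]) / inner a a" for v
  have slope: "inner v q - inner v p = slope v * (y q - y p)" if "inner a p = inner a q" for v p q
    using inner_orthogonal_coordinates[OF a(1), of v p] inner_orthogonal_coordinates[OF a(1), of v q] that
    unfolding slope_def y_def right_diff_distrib by simp

  define T where "T K = {t. t < n \<and> e t \<in> K}" for K
  define l where "l K = Min (T K)" for K
  define r where "r K = Max (T K)" for K
  \<comment> \<open>A part also occupies the columns between its first and last point whose own
    point belongs to another part.\<close>
  define act where "act = (\<lambda>K t. K \<in> P \<and> l K \<le> t \<and> t \<le> r K)"
  have finT: "finite (T K)" for K
    by (simp add: T_def)
  have T_ne: "T K \<noteq> {}" if K: "K \<in> P" for K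
  proof -
    obtain p where "p \<in> K" using ne[OF K] by blast
    then obtain t where "t < n" "e t = p"
      using e sub[OF K] by (force simp: bij_betw_def)
    then show ?thesis using \<open>p \<in> K\<close> by (auto simp: T_def)
  qed
  have l: "l K < n" "e (l K) \<in> K" and r: "r K < n" "e (r K) \<in> K" if "K \<in> P" for K
    using Min_in[OF finT T_ne[OF that]] Max_in[OF finT T_ne[OF that]]
    by (auto simp: l_def r_def T_def)
  have act_T: "act K t" if "K \<in> P" "t \<in> T K" for K t
    using that finT Min_le[of "T K" t] Max_ge[of "T K" t] by (auto simp: act_def l_def r_def)
  have l_le_r: "l K \<le> r K" if "K \<in> P" for K
    using finT T_ne[OF that] by (simp add: l_def r_def)
  have same_part: "I = J" if "I \<in> P" "J \<in> P" "p \<in> I" "p \<in> J" for I J p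
    using part that by (auto simp: partition_on_def disjoint_def)
  have "inj_on l P" "inj_on r P"
    using l(2) r(2) same_part by (metis inj_onI)+

  \<comment> \<open>The hull projects onto an interval along \<open>a\<close>, so it meets every
    column in between. Preferring \<open>e t\<close> when it lies in \<open>K\<close> lets equal
    heights detect membership later.\<close>
  have q_ex: "\<exists>q. q \<in> convex hull K \<and> inner a q = inner a (e t) \<and> (e t \<in> K \<longrightarrow> q = e t)"
    if act: "act K t" for K t
  proof (cases "e t \<in> K")
    case True
    then show ?thesis by (intro exI[of _ "e t"]) (simp add: hull_inc)
  next
    case False
    have K: "K \<in> P" "l K \<le> t" "t \<le> r K" using act by (auto simp: act_def)
    have "inner a (e (l K)) \<le> inner a (e t)" "inner a (e t) \<le> inner a (e (r K))"
      using strict_mono_on_leD[OF mono_e, of "l K" t] strict_mono_on_leD[OF mono_e, of t "r K"]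
        K(2,3) r(1)[OF K(1)] by simp_all
    moreover have "is_interval (inner a ` (convex hull K))"
      unfolding is_interval_convex_1
      by (intro convex_linear_image bounded_linear.linear bounded_linear_inner_right convex_convex_hull)
    moreover have "e (l K) \<in> convex hull K" "e (r K) \<in> convex hull K"
      using l(2)[OF K(1)] r(2)[OF K(1)] by (simp_all add: hull_inc)
    ultimately have "inner a (e t) \<in> inner a ` (convex hull K)"
      by (meson imageI mem_is_interval_1_I)
    then obtain q where "q \<in> convex hull K" "inner a q = inner a (e t)"
      by (metis imageE)
    then show ?thesis using False by blast
  qed
  define q where "q K t = (SOME q. q \<in> convex hull K \<and> inner a q = inner a (e t) \<and> (e t \<in> K \<longrightarrow> q = e t))"
    for K t
  have q: "q K t \<in> convex hull K \<and> inner a (q K t) = inner a (e t) \<and> (e t \<in> K \<longrightarrow> q K t = e t)"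
    if "act K t" for K t
    unfolding q_def using q_ex[OF that] by (rule someI_ex)
  define h where "h K t = y (q K t)" for K t

  define separates where "separates v c I J \<longleftrightarrow>
      0 < slope v \<and> (\<forall>p\<in>convex hull I. inner v p < c) \<and> (\<forall>p\<in>convex hull J. c < inner v p)"
    for v c I J
  define below where "below I J \<longleftrightarrow> (\<exists>v c. separates v c I J)" for I J
  \<comment> \<open>One separating line is fixed per pair of parts, independently of the column, so
    that a constant neighbour gives a constant halfplane.\<close>
  have "\<forall>I J. \<exists>v c. below I J \<longrightarrow> separates v c I J"
    unfolding below_def by blast
  then obtain v c where vc: "separates (v I J) (c I J) I J" if "below I J" for I J
    unfolding choice_iff by blast
  define U where "U I J = {p. inner (v I J) p < c I J}" for I J

  have below_less: "h I t < h J t" if "below I J" "act I t" "act J t" for I J t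
  proof -
    have sep: "separates (v I J) (c I J) I J" using vc that(1) .
    have "inner (v I J) (q I t) < inner (v I J) (q J t)"
      using sep q[OF that(2)] q[OF that(3)] by (force simp: separates_def)
    then have "0 < slope (v I J) * (h J t - h I t)"
      using slope[of "q I t" "q J t" "v I J"] q[OF that(2)] q[OF that(3)] by (simp add: h_def)
    then show ?thesis
      using sep by (simp add: separates_def zero_less_mult_iff)
  qed
  have below_total: "below I J \<or> below J I" if IJ: "act I t" "act J t" "I \<noteq> J" for I J t
  proof -
    have P: "I \<in> P" "J \<in> P" using IJ by (auto simp: act_def)
    have "\<exists>w d. (\<forall>p\<in>convex hull I. inner w p < d) \<and> (\<forall>p\<in>convex hull J. inner w p > d)"
      using hulls[OF P IJ(3)] ne[OF P(1)] finK[OF P(1)] finK[OF P(2)]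
      by (intro separating_hyperplane_compact_closed)
        (simp_all add: compact_imp_closed finite_imp_compact_convex_hull)
    then obtain w d where w: "\<forall>p\<in>convex hull I. inner w p < d" "\<forall>p\<in>convex hull J. inner w p > d"
      by blast
    \<comment> \<open>Both hulls meet column \<open>t\<close>, so the separating line cannot be
      parallel to the columns; its normal or the opposite one points upwards.\<close>
    have "inner w (q I t) < inner w (q J t)"
      using w q[OF IJ(1)] q[OF IJ(2)] by (meson less_trans)
    then have "slope w \<noteq> 0"
      using slope[of "q I t" "q J t" w] q[OF IJ(1)] q[OF IJ(2)] by auto
    moreover have "slope (- w) = - slope w"
      by (simp add: slope_def)
    ultimately consider "0 < slope w" | "0 < slope (- w)"
      by fastforce
    then show ?thesis
    proof cases
      case 1
      then have "separates w d I J" using w by (auto simp: separates_def)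
      then show ?thesis by (auto simp: below_def)
    next
      case 2
      then have "separates (- w) (- d) J I" using w by (auto simp: separates_def)
      then show ?thesis by (auto simp: below_def)
    qed
  qed
  have inj_h: "I = J" if "act I t" "act J t" "h I t = h J t" for I J t
    using below_total[OF that(1,2)] below_less[of I J t] below_less[of J I t] that by force
  have less_below: "below I J" if "act I t" "act J t" "h I t < h J t" for I J t
    using below_total[OF that(1,2)] below_less[of J I t] that by force
  \<comment> \<open>The relation \<open>below\<close> does not mention columns, so the order of two
    parts is the same wherever both occur.\<close>
  have mono_h: "h I t < h J t" if "act I s" "act J s" "act I t" "act J t" "h I s < h J s" for I J s t
    using less_below[OF that(1,2,5)] below_less that by blast

  define \<sigma> :: "point \<Rightarrow> int" where "\<sigma> p = (if p \<in> R then 1 else - 1)" for p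
  \<comment> \<open>Signed count in \<open>A\<close> of the first \<open>t\<close> points of the
    sweep. Capping at \<open>n\<close> lets the bound below hold for every \<open>t\<close>.\<close>
  define W where "W A t = (\<Sum>s<min t n. if e s \<in> A then \<sigma> (e s) else 0)" for A t
  have W_Suc: "W A (Suc t) - W A t = (if e t \<in> A then \<sigma> (e t) else 0)" if "t < n" for A t
    using that by (simp add: W_def min_def Suc_le_eq)
  obtain H0 :: "point set" where H0: "halfplane H0"
    using a(1) unfolding halfplane_def by blast
  have M0: "0 \<le> M"
    using disc_wedge_le_Max[OF finS H0 H0, of R B] by (auto simp: M_def disc_def)
  have W_bound: "\<bar>W A t\<bar> \<le> M" if A: "halfplane A \<or> A = UNIV \<or> A = {}" for A t
  proof (cases "min t n = 0 \<or> A = {}")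
    case True
    then show ?thesis using M0 by (auto simp: W_def)
  next
    case False
    define m where "m = min t n - 1"
    have m: "m < n" "min t n = Suc m" using False by (auto simp: m_def)
    \<comment> \<open>\<open>m\<close> is the last index counted, so \<open>H\<close> cuts off
      exactly the first \<open>min t n\<close> points, and a halfplane \<open>A\<close> completes it
      to a wedge.\<close>
    define H where "H = {p. inner a p \<le> inner a (e m)}"
    have H: "halfplane H" using a(1) by (auto simp: halfplane_def H_def)
    have inj_e: "inj_on e {..<Suc m}"
      using e m by (auto simp: bij_betw_def intro: inj_on_subset)
    have img: "e ` {..<Suc m} = H \<inter> S"
    proof
      show "e ` {..<Suc m} \<subseteq> H \<inter> S"
        using e m strict_mono_on_leD[OF mono_e, of _ m] by (auto simp: bij_betw_def H_def)
      show "H \<inter> S \<subseteq> e ` {..<Suc m}"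
      proof
        fix p assume p: "p \<in> H \<inter> S"
        then obtain s where s: "s < n" "p = e s" using e by (force simp: bij_betw_def)
        have "s \<le> m"
          using strict_mono_onD[OF mono_e, of m s] p s m by (force simp: H_def)
        then show "p \<in> e ` {..<Suc m}" using s by auto
      qed
    qed
    have "W A t = (\<Sum>p\<in>H \<inter> S. if p \<in> A then \<sigma> p else 0)"
      unfolding W_def m(2) img[symmetric] by (simp add: sum.reindex[OF inj_e])
    also have "\<dots> = (\<Sum>p\<in>H \<inter> A \<inter> S. \<sigma> p)"
      using finS by (auto simp: sum.If_cases Int_ac intro!: sum.cong)
    also have "\<dots> = weight R B (H \<inter> A \<inter> S)"
      using finS RB unfolding \<sigma>_def by (intro weight_eq_sum[symmetric]) (auto simp: S_def)
    also have "\<bar>\<dots>\<bar> \<le> M"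
      using A False disc_wedge_le_Max[OF finS H H, of R B] disc_wedge_le_Max[OF finS H, of A R B]
      unfolding M_def disc_eq_abs_weight[symmetric] by auto
    finally show ?thesis .
  qed
  have U: "halfplane (U I J)" if "below I J" for I J
  proof -
    have "slope (v I J) > 0" using vc[OF that] by (simp add: separates_def)
    then have "v I J \<noteq> 0" by (auto simp: slope_def)
    then show ?thesis unfolding U_def halfplane_def by blast
  qed

  \<comment> \<open>\<open>F\<close> counts what lies under the line towards the upper neighbour,
    \<open>G\<close> what lies under the line towards the lower one; a missing neighbour makes this
    everything or nothing. The value \<open>{}\<close> for unrelated pairs keeps the bound valid for
    all arguments.\<close>
  define F where "F K u t = (case u of None \<Rightarrow> W UNIV t | Some J \<Rightarrow> W (if below K J then U K J else {}) t)"
    for K u t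
  define G where "G K u t = (case u of None \<Rightarrow> W {} t | Some J \<Rightarrow> W (if below J K then U J K else {}) t)"
    for K u t
  have FG: "\<bar>F K u t\<bar> \<le> M" "\<bar>G K u t\<bar> \<le> M" for K u t
    unfolding F_def G_def using U by (auto intro!: W_bound split: option.split)
  define up where "up = next_above act h"
  define dn where "dn = next_above act (\<lambda>K t. - h K t)"
  have fin_act: "finite {K. act K t}" for t
    using finP by (auto simp: act_def)

  \<comment> \<open>Let \<open>L\<close> be the part of \<open>e t\<close>. \<open>F\<close> gains
    this point iff \<open>L\<close> is not above \<open>K\<close> in the column, \<open>G\<close>
    iff \<open>L\<close> is strictly below; the difference leaves equal heights, that is,
    \<open>e t\<close> in \<open>K\<close>.\<close>
  have column: "(F K (up K t) (Suc t) - F K (up K t) t) - (G K (dn K t) (Suc t) - G K (dn K t) t)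
      = (if e t \<in> K then \<sigma> (e t) else 0)" if act: "act K t" for K t
  proof -
    have K: "K \<in> P" "t \<le> r K" using act by (simp_all add: act_def)
    have t: "t < n" using K(2) r(1)[OF K(1)] by simp
    then have "e t \<in> S" using e by (auto simp: bij_betw_def)
    then obtain L where L: "L \<in> P" "e t \<in> L"
      using partition_onD1[OF part] by blast
    have actL: "act L t" using act_T[OF L(1)] L(2) t by (simp add: T_def)
    have qL: "y (e t) = h L t" using q[OF actL] L by (simp add: h_def)
    have in_U: "e t \<in> U I J" if "h L t \<le> h I t" "act I t" "below I J" for I J
    proof -
      have sep: "separates (v I J) (c I J) I J" using vc that(3) .
      have "0 \<le> slope (v I J) * (y (q I t) - y (e t))"
        using sep that(1) qL by (simp add: separates_def h_def)
      then have "inner (v I J) (e t) \<le> inner (v I J) (q I t)"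
        using slope[of "e t" "q I t" "v I J"] q[OF that(2)] by simp
      also have "\<dots> < c I J"
        using sep q[OF that(2)] by (simp add: separates_def)
      finally show ?thesis by (simp add: U_def)
    qed
    have not_in_U: "e t \<notin> U I J" if "h J t \<le> h L t" "act J t" "below I J" for I J
    proof -
      have sep: "separates (v I J) (c I J) I J" using vc that(3) .
      have "0 \<le> slope (v I J) * (y (e t) - y (q J t))"
        using sep that(1) qL by (simp add: separates_def h_def)
      then have "inner (v I J) (q J t) \<le> inner (v I J) (e t)"
        using slope[of "q J t" "e t" "v I J"] q[OF that(2)] by simp
      moreover have "c I J < inner (v I J) (q J t)"
        using sep q[OF that(2)] by (simp add: separates_def)
      ultimately show ?thesis by (simp add: U_def)
    qed
    have "F K (up K t) (Suc t) - F K (up K t) t = (if h L t \<le> h K t then \<sigma> (e t) else 0)"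
    proof (cases "up K t")
      case None
      then show ?thesis
        using next_above_None[of act h K t L] actL W_Suc[OF t] by (simp add: F_def up_def)
    next
      case (Some J)
      note J = next_above_Some[OF fin_act Some[unfolded up_def]]
      have "below K J" using less_below[OF act J(1,2)] .
      \<comment> \<open>If \<open>L\<close> is above \<open>K\<close>, it is at least as high as the
        nearest such part \<open>J\<close>, so its point lies beyond the line separating
        \<open>K\<close> from \<open>J\<close>.\<close>
      have "e t \<in> U K J \<longleftrightarrow> h L t \<le> h K t"
      proof (cases "h L t \<le> h K t")
        case True
        then show ?thesis using in_U[OF True act \<open>below K J\<close>] by simp
      next
        case False
        then have "h J t \<le> h L t" using J(3)[OF actL] by simp
        then show ?thesis using not_in_U[OF _ J(1) \<open>below K J\<close>] False by simp
      qed
      then show ?thesis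
        using Some \<open>below K J\<close> W_Suc[OF t] by (simp add: F_def)
    qed
    moreover have "G K (dn K t) (Suc t) - G K (dn K t) t = (if h L t < h K t then \<sigma> (e t) else 0)"
    proof (cases "dn K t")
      case None
      then show ?thesis
        using next_above_None[of act "\<lambda>K t. - h K t" K t L] actL W_Suc[OF t] by (simp add: G_def dn_def)
    next
      case (Some J)
      note J = next_above_Some[OF fin_act Some[unfolded dn_def]]
      have JK: "h J t < h K t" using J(2) by simp
      have "below J K" using less_below[OF J(1) act JK] .
      moreover have "h L t < h K t \<Longrightarrow> h L t \<le> h J t" using J(3)[OF actL] by simp
      ultimately have "e t \<in> U J K \<longleftrightarrow> h L t < h K t"
        using in_U[of J K] not_in_U[of K J] J(1) act by (meson not_less)
      then show ?thesis
        using Some \<open>below J K\<close> W_Suc[OF t] by (simp add: G_def)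
    qed
    moreover have "h L t = h K t \<longleftrightarrow> e t \<in> K"
    proof
      assume "h L t = h K t"
      then show "e t \<in> K" using inj_h[OF actL act] L(2) by simp
    next
      assume "e t \<in> K"
      then show "h L t = h K t" using same_part[OF L(1) K(1) L(2)] by simp
    qed
    ultimately show ?thesis by (cases "h L t" "h K t" rule: linorder_cases) simp_all
  qed

  let ?A = "\<lambda>K. \<Sum>t\<in>{l K..r K}. F K (up K t) (Suc t) - F K (up K t) t"
  let ?D = "\<lambda>K. \<Sum>t\<in>{l K..r K}. G K (dn K t) (Suc t) - G K (dn K t) t"
  have disc: "disc R B K \<le> \<bar>?A K\<bar> + \<bar>?D K\<bar>" if K: "K \<in> P" for K
  proof -
    \<comment> \<open>Summing the column identity over the range of \<open>K\<close> leaves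
      precisely the points of \<open>K\<close>.\<close>
    have "?A K - ?D K = (\<Sum>t\<in>{l K..r K}. if e t \<in> K then \<sigma> (e t) else 0)"
      unfolding sum_subtractf[symmetric] using K by (intro sum.cong column) (auto simp: act_def)
    also have "\<dots> = (\<Sum>t\<in>T K. \<sigma> (e t))"
    proof -
      have "{l K..r K} \<inter> {t. e t \<in> K} = T K"
        using act_T[OF K] r[OF K] by (fastforce simp: act_def T_def)
      then show ?thesis by (simp add: sum.If_cases)
    qed
    also have "\<dots> = (\<Sum>p\<in>K. \<sigma> p)"
    proof (rule sum.reindex_bij_betw)
      show "bij_betw e (T K) K"
        using e sub[OF K] by (force simp: bij_betw_def T_def inj_on_def)
    qed
    also have "\<dots> = weight R B K"
      using finK[OF K] RB sub[OF K] unfolding \<sigma>_def by (intro weight_eq_sum[symmetric]) (auto simp: S_def)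
    finally show ?thesis by (simp add: disc_eq_abs_weight)
  qed
  have "(\<Sum>K\<in>P. \<bar>?A K\<bar>) \<le> 6 * M * int (card P)"
    unfolding up_def act_def using inj_h mono_h FG(1)
    by (intro sweep_bound[OF finP \<open>inj_on l P\<close> \<open>inj_on r P\<close> l_le_r]) (simp_all only: act_def)
  \<comment> \<open>Turning the picture upside down by negating heights makes lower neighbours upper
    ones.\<close>
  moreover have "(\<Sum>K\<in>P. \<bar>?D K\<bar>) \<le> 6 * M * int (card P)"
    unfolding dn_def act_def
  proof (rule sweep_bound[OF finP \<open>inj_on l P\<close> \<open>inj_on r P\<close> l_le_r])
    fix I J s t
    assume "I \<in> P \<and> l I \<le> s \<and> s \<le> r I" "J \<in> P \<and> l J \<le> s \<and> s \<le> r J"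
      "I \<in> P \<and> l I \<le> t \<and> t \<le> r I" "J \<in> P \<and> l J \<le> t \<and> t \<le> r J" "- h I s < - h J s"
    then show "- h I t < - h J t"
      using mono_h[of J s I t] by (simp add: act_def)
  next
    fix I J t
    assume "I \<in> P \<and> l I \<le> t \<and> t \<le> r I" "J \<in> P \<and> l J \<le> t \<and> t \<le> r J" "- h I t = - h J t"
    then show "I = J"
      using inj_h[of I t J] by (simp add: act_def)
  qed (simp_all add: FG(2))
  moreover have "(\<Sum>K\<in>P. disc R B K) \<le> (\<Sum>K\<in>P. \<bar>?A K\<bar> + \<bar>?D K\<bar>)"
    by (intro sum_mono disc)
  ultimately show ?thesis
    by (simp add: sum.distrib M_def S_def)
qed

section \<open>Comparison of the coarseness with the best 2-separable island\<close>

text \<open>In an optimal partition every part has discrepancy at least the coarseness, so the bound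
  on the sum can be divided by the number of parts.\<close>

lemma coarseness_le_separable:
  assumes fin: "finite (R \<union> B)" and ne: "R \<union> B \<noteq> {}" and RB: "R \<inter> B = {}"
  shows "coarseness R B \<le> 12 * Max (disc R B ` separable_islands 2 (R \<union> B))"
proof -
  have "coarseness R B \<in> disc_partition R B ` {P. convex_partition (R \<union> B) P}"
    unfolding coarseness_def
    using finite_convex_partitions[OF fin] convex_partition_trivial[OF ne] by (intro Max_in) auto
  then obtain P where P: "convex_partition (R \<union> B) P" "coarseness R B = disc_partition R B P"
    by blast
  note finP = convex_partition_finite_nonempty[OF fin ne P(1)]
  have "int (card P) * coarseness R B = (\<Sum>K\<in>P. disc_partition R B P)"
    using P(2) by simp
  also have "\<dots> \<le> (\<Sum>K\<in>P. disc R B K)"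
    unfolding disc_partition_def using finP by (intro sum_mono Min_le) auto
  also have "\<dots> \<le> int (card P) * (12 * Max (disc R B ` separable_islands 2 (R \<union> B)))"
    using sum_disc_convex_partition_le[OF fin RB P(1)] by (simp add: mult_ac)
  finally show ?thesis
    using finP by (simp add: card_gt_0_iff)
qed

theorem theorem14:
  fixes S R B :: "point set" and r b :: nat and D\<^sub>2 :: int
  assumes "finite S" and "S \<noteq> {}"
    and "S = R \<union> B" and "R \<inter> B = {}"
    and "general_position S"
    and "r = card R" and "b = card B"
    and "D\<^sub>2 = Max (disc R B ` separable_islands 2 S)"
  shows "max (real_of_int (coarseness R B) / 128)
             (real_of_int (coarseness R B) / 64 - \<bar>real r - real b\<bar>)
           \<le> max (real_of_int D\<^sub>2 / 8) (real_of_int D\<^sub>2 / 4 - \<bar>real r - real b\<bar>)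
         \<and> max (real_of_int D\<^sub>2 / 8) (real_of_int D\<^sub>2 / 4 - \<bar>real r - real b\<bar>)
           \<le> real_of_int (coarseness R B)"
proof -
  have fin: "finite (R \<union> B)" and ne: "R \<union> B \<noteq> {}"
    using assms by auto
  have "(R \<union> B) \<inter> R = R" "(R \<union> B) \<inter> B = B"
    by auto
  then have s: "\<bar>real r - real b\<bar> = real_of_int \<bar>weight R B (R \<union> B)\<bar>"
    using assms(6,7) by (simp add: weight_def)
  have "D\<^sub>2 \<in> disc R B ` separable_islands 2 S"
    unfolding assms(8) using finite_separable_islands[OF assms(1)] self_in_separable_islands[OF assms(1), of 2]
    by (intro Max_in) auto
  then obtain H G where HG: "halfplane H" "halfplane G" "D\<^sub>2 = \<bar>weight R B (H \<inter> G \<inter> S)\<bar>"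
    by (auto simp: separable_islands_2 disc_eq_abs_weight)
  have "D\<^sub>2 - 4 * \<bar>weight R B (R \<union> B)\<bar> \<le> 4 * coarseness R B"
    using coarseness_ge_wedge[OF fin ne HG(1,2)] HG(3) assms(3) by simp
  moreover have "\<bar>weight R B (R \<union> B)\<bar> \<le> coarseness R B"
    using weight_le_coarseness[OF fin ne] .
  moreover have "coarseness R B \<le> 12 * D\<^sub>2"
    using coarseness_le_separable[OF fin ne assms(4)] assms(3,8) by simp
  moreover have "0 \<le> D\<^sub>2"
    using HG(3) by simp
  ultimately have "real_of_int D\<^sub>2 - 4 * \<bar>real r - real b\<bar> \<le> 4 * real_of_int (coarseness R B)"
    "\<bar>real r - real b\<bar> \<le> real_of_int (coarseness R B)"
    "real_of_int (coarseness R B) \<le> 12 * real_of_int D\<^sub>2" "0 \<le> real_of_int D\<^sub>2"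
    unfolding s by linarith+
  \<comment> \<open>The left inequality needs only the factor 16 in place of 12. On the right,
    \<open>D\<^sub>2 / 8\<close> is the mean of \<open>\<bar>real r - real b\<bar>\<close> and
    \<open>D\<^sub>2 / 4 - \<bar>real r - real b\<bar>\<close>, both at most the coarseness.\<close>
  then show ?thesis
    by (auto simp: max_def field_simps)
qed

end
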